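(* Let $z\in\mathbb{C}$ with $z\notin\{-1,-2,-3,\dots\}$. Then $$\prod_{k=1}^{\infty}\begin{bmatrix}-\dfrac{k^{6}}{2k(2k+1)(z+k+1)^{4}} & 5k^{2}+6kz+2z^{2}\\ 0 & 1\end{bmatrix}=\begin{bmatrix}0 & 4(z+1)^{4}\zeta(z+1,3)\\ 0 & 1\end{bmatrix},$$ or equivalently $$\prod_{k=1}^{\infty}\begin{bmatrix}-\dfrac{k^{6}}{2k(2k+1)(z+k+1)^{4}} & \dfrac{5k^{2}+6kz+2z^{2}}{4(z+1)^{4}}\\ 0 & 1\end{bmatrix}=\begin{bmatrix}0 & \zeta(z+1,3)\\ 0 & 1\end{bmatrix}.$$
   Context: $\zeta(z+1,3):=\sum_{n=1}^{\infty}\frac{1}{(n+z)^{3}}$ (a Hurwitz zeta value). The infinite product $\prod_{k=1}^\infty \mathbf{M}_k$ of square matrices means the entrywise limit as $m\to\infty$ of the ordered products $\mathbf{M}_1\mathbf{M}_2\cdots\mathbf{M}_m$ (factors multiplied from left to right in increasing index). *)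

theory Defs
  imports "HOL-Analysis.Analysis"
begin

primrec matrix_partial_prod ::
  "(nat \<Rightarrow> 'a::semiring_1 ^ 'n::finite ^ 'n) \<Rightarrow> nat \<Rightarrow> 'a ^ 'n ^ 'n" where
  "matrix_partial_prod M 0 = mat 1"
| "matrix_partial_prod M (Suc m) = matrix_partial_prod M m ** M (Suc m)"

text \<open>
  Factors are indexed from 1 (the value \<open>M 0\<close> is never used) and multiplied from left to right.
  The limit is taken entrywise; it is allowed to be singular.
\<close>
definition has_matrix_prod ::
  "(nat \<Rightarrow> 'a::{semiring_1, topological_space} ^ 'n::finite ^ 'n) \<Rightarrow> 'a ^ 'n ^ 'n \<Rightarrow> bool" where
  "has_matrix_prod M L \<longleftrightarrow>
     (\<forall>i j. (\<lambda>m. matrix_partial_prod M m $ i $ j) \<longlonglongrightarrow> L $ i $ j)"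

text \<open>
  The argument order is \<open>\<zeta>(a, s)\<close> with the shift \<open>a\<close> first. Only integer exponents \<open>s \<ge> 2\<close> are meaningful.
\<close>
definition hurwitz_zeta :: "complex \<Rightarrow> nat \<Rightarrow> complex" where
  "hurwitz_zeta a s = (\<Sum>n. 1 / (of_nat n + a) ^ s)"

lemma hurwitz_zeta_plus_1:
  "hurwitz_zeta (z + 1) s = (\<Sum>n. 1 / (of_nat (Suc n) + z) ^ s)"
  by (simp add: hurwitz_zeta_def add_ac)

lemma summable_hurwitz_zeta_3: "summable (\<lambda>n. 1 / (of_nat n + a :: complex) ^ 3)"
proof (rule summable_comparison_test_ev)
  have "eventually (\<lambda>n. 2 * norm a + 1 \<le> real n) sequentially"
    using eventually_ge_at_top[of "nat \<lceil>2 * norm a + 1\<rceil>"]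
    by eventually_elim linarith
  then show "eventually (\<lambda>n. norm (1 / (of_nat n + a) ^ 3) \<le> 8 * inverse (real n ^ 3)) sequentially"
  proof eventually_elim
    case (elim n)
    have pos: "real n / 2 > 0"
      using elim norm_ge_zero[of a] by linarith
    have "real n - norm a \<le> norm (of_nat n + a)"
      by (metis norm_diff_ineq norm_of_nat)
    then have "real n / 2 \<le> norm (of_nat n + a)"
      using elim by linarith
    then have "(real n / 2) ^ 3 \<le> norm (of_nat n + a) ^ 3"
      using pos by (intro power_mono) auto
    then have "1 / norm (of_nat n + a) ^ 3 \<le> 1 / (real n / 2) ^ 3"
      using pos by (intro divide_left_mono mult_pos_pos) (auto intro: less_le_trans zero_less_power)
    also have "\<dots> = 8 * inverse (real n ^ 3)"
      by (simp add: power_divide divide_simps)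
    finally show ?case
      by (simp add: norm_divide norm_power)
  qed
  show "summable (\<lambda>n. 8 * inverse (real n ^ 3))"
    by (intro summable_mult inverse_power_summable) simp
qed

end

theory Submission
  imports Defs
begin

text \<open>
  The product reduces to the series of Markov, which is summed by a WZ pair.
  With \<open>h(n, x) = (-1)^n n!^6 / ((2n)! ((x+1)\<cdots>(x+n+1))^4)\<close> put
  \<open>F(n, x) = h(n, x) (2x + n + 2) / 2\<close> and
  \<open>G(n, x) = h(n, x) (5(n+1)^2 + 6(n+1)x + 2x^2) / (4(2n+1))\<close>. Then
  \<open>F(n+1, x) - F(n, x) = G(n, x+1) - G(n, x)\<close>, and \<open>F(0, x) = 1 / (x+1)^3\<close>.
  Summing over \<open>x = z, z+1, \<dots>\<close> shows that \<open>\<Sum>n<N. G(n, z)\<close> differs from the Hurwitz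
  zeta value by \<open>\<Sum>k. F(N, z+k)\<close>, which tends to zero geometrically since
  \<open>F(n+1, z+k) / F(n, z+k)\<close> is roughly at most \<open>1/4\<close> in absolute value for large \<open>n\<close>, uniformly in \<open>k\<close>.
\<close>

section \<open>Products of affine 2x2 matrices as partial sums\<close>

lemma vector_2x2_eq_iff:
  fixes A :: "'a::zero ^ 2 ^ 2"
  shows "A = vector [vector [a, b], vector [c, d]] \<longleftrightarrow>
    A $ 1 $ 1 = a \<and> A $ 1 $ 2 = b \<and> A $ 2 $ 1 = c \<and> A $ 2 $ 2 = d"
  by (auto simp: vec_eq_iff forall_2)

text \<open>Each factor encodes the affine map taking \<open>t\<close> to
  \<open>a k * t + b k\<close>, and matrix multiplication is composition: a new factor on the right
  sends its \<open>b\<close> through the linear parts accumulated so far.\<close>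

lemma matrix_partial_prod_affine:
  fixes a b :: "nat \<Rightarrow> 'a::comm_semiring_1"
  shows "matrix_partial_prod (\<lambda>k. vector [vector [a k, b k], vector [0, 1]] :: 'a ^ 2 ^ 2) m =
    vector [vector [\<Prod>k=1..m. a k, \<Sum>n<m. (\<Prod>k=1..n. a k) * b (Suc n)], vector [0, 1]]"
proof (induction m)
  case 0
  show ?case by (simp add: vector_2x2_eq_iff mat_def)
next
  case (Suc m)
  show ?case
    unfolding matrix_partial_prod.simps Suc
    by (simp add: vector_2x2_eq_iff matrix_matrix_mult_def sum_2 ac_simps)
qed

lemma has_matrix_prod_affineI:
  fixes a b :: "nat \<Rightarrow> 'a::{comm_semiring_1, topological_space}"
  assumes "(\<lambda>m. \<Prod>k=1..m. a k) \<longlonglongrightarrow> A"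
    and "(\<lambda>n. (\<Prod>k=1..n. a k) * b (Suc n)) sums B"
  shows "has_matrix_prod (\<lambda>k. vector [vector [a k, b k], vector [0, 1]] :: 'a ^ 2 ^ 2)
    (vector [vector [A, B], vector [0, 1]])"
  using assms unfolding has_matrix_prod_def matrix_partial_prod_affine sums_def
  by (simp add: forall_2)

section \<open>The WZ pair and its recurrences\<close>

definition markov_h :: "nat \<Rightarrow> complex \<Rightarrow> complex" where
  "markov_h n x = (- 1) ^ n * fact n ^ 6 / (fact (2 * n) * pochhammer (x + 1) (Suc n) ^ 4)"

definition markov_F :: "nat \<Rightarrow> complex \<Rightarrow> complex" where
  "markov_F n x = markov_h n x * (2 * x + of_nat n + 2) / 2"

text \<open>The polynomial is the upper right entry of the factor with index
  \<open>k = Suc n\<close>, so summing from \<open>n = 0\<close> matches factors counted from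
  1.\<close>

definition markov_G :: "nat \<Rightarrow> complex \<Rightarrow> complex" where
  "markov_G n x = markov_h n x *
     (5 * of_nat (Suc n) ^ 2 + 6 * of_nat (Suc n) * x + 2 * x ^ 2) / (4 * of_nat (2 * n + 1))"

text \<open>Of the six new factors \<open>n + 1\<close>, one cancels against
  \<open>2 * n + 2\<close> in the new factorial, leaving the fifth power and a 2. Where a Pochhammer
  factor vanishes, both sides are 0 by division by zero.\<close>

lemma markov_h_Suc:
  "markov_h (Suc n) x =
     - (of_nat (Suc n) ^ 5 / (2 * of_nat (2 * n + 1) * (x + of_nat n + 2) ^ 4)) * markov_h n x"
proof -
  have 1: "pochhammer (x + 1) (Suc (Suc n)) = pochhammer (x + 1) (Suc n) * (x + of_nat n + 2)"
    by (subst pochhammer_Suc) (simp add: algebra_simps)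
  have 2: "fact (2 * Suc n) = (2 * of_nat (Suc n) * of_nat (2 * n + 1) * fact (2 * n) :: complex)"
    by (simp add: algebra_simps)
  have 3: "fact (Suc n) = (of_nat (Suc n) * fact n :: complex)"
    by simp
  define m :: complex where "m = of_nat (Suc n)"
  have "m \<noteq> 0" unfolding m_def by (simp only: of_nat_eq_0_iff)
  moreover have "m ^ 6 = m ^ 5 * m"
    by (simp add: power_numeral_reduce)
  ultimately show ?thesis
    unfolding markov_h_def 1 2 3 m_def[symmetric]
    by (simp add: power_mult_distrib divide_simps del: of_nat_Suc of_nat_add)
qed

text \<open>Splitting \<open>pochhammer (x + 1) (n + 2)\<close> once at its last and once at its
  first factor compares the Pochhammer symbols at \<open>x + 1\<close> and
  \<open>x + 2\<close>.\<close>

lemma markov_h_shift: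
  assumes "x + 1 \<noteq> 0"
  shows "markov_h n (x + 1) = ((x + 1) / (x + of_nat n + 2)) ^ 4 * markov_h n x"
proof -
  have "pochhammer (x + 1) (Suc (Suc n)) = pochhammer (x + 1) (Suc n) * (x + of_nat n + 2)"
    by (subst pochhammer_Suc) (simp add: algebra_simps)
  moreover have "pochhammer (x + 1) (Suc (Suc n)) = (x + 1) * pochhammer (x + 1 + 1) (Suc n)"
    by (subst pochhammer_rec) simp
  ultimately have "pochhammer (x + 1 + 1) (Suc n) = pochhammer (x + 1) (Suc n) * (x + of_nat n + 2) / (x + 1)"
    using assms by (simp add: field_simps)
  then show ?thesis
    unfolding markov_h_def by (simp only: power_mult_distrib power_divide) (simp add: mult_ac)
qed

text \<open>This is what the WZ relation becomes, with \<open>u = x + 1\<close> and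
  \<open>m = n + 1\<close>, once the common hypergeometric factor is removed. It rests on
  \<open>m^2 - 2mu + 2u^2\<close>: its product with \<open>(u + m)^4\<close> has no
  \<open>u^3 m^3\<close> and \<open>u^2 m^4\<close> terms, and it differs from the shifted quadratic
  by \<open>2(2m - 1)(2u + m - 1)\<close>.\<close>

lemma markov_WZ_polynomial:
  fixes u m :: "'a::comm_ring_1"
  shows "- (m ^ 5 * (2 * u + m)) - 2 * (2 * m - 1) * (2 * u + m - 1) * (u + m) ^ 4 =
    u ^ 4 * (5 * m ^ 2 + 6 * m * u + 2 * u ^ 2)
      - (u + m) ^ 4 * (5 * m ^ 2 + 6 * m * (u - 1) + 2 * (u - 1) ^ 2)"
proof -
  have "(u + m) ^ 2 * (u + m) ^ 2 * (m ^ 2 - 2 * m * u + 2 * u ^ 2) =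
      u ^ 4 * (5 * m ^ 2 + 6 * m * u + 2 * u ^ 2) + m ^ 5 * (2 * u + m)"
    by (simp add: algebra_simps power_numeral_reduce)
  then have *: "(u + m) ^ 4 * (m ^ 2 - 2 * m * u + 2 * u ^ 2) =
      u ^ 4 * (5 * m ^ 2 + 6 * m * u + 2 * u ^ 2) + m ^ 5 * (2 * u + m)"
    by (simp flip: power_add)
  have "5 * m ^ 2 + 6 * m * (u - 1) + 2 * (u - 1) ^ 2 =
      (m ^ 2 - 2 * m * u + 2 * u ^ 2) + 2 * (2 * m - 1) * (2 * u + m - 1)"
    by (simp add: algebra_simps power2_eq_square)
  then have "(u + m) ^ 4 * (5 * m ^ 2 + 6 * m * (u - 1) + 2 * (u - 1) ^ 2) =
      (u ^ 4 * (5 * m ^ 2 + 6 * m * u + 2 * u ^ 2) + m ^ 5 * (2 * u + m))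
      + (u + m) ^ 4 * (2 * (2 * m - 1) * (2 * u + m - 1))"
    by (simp only: distrib_left[of "(u + m) ^ 4" "m ^ 2 - 2 * m * u + 2 * u ^ 2"] *)
  then show ?thesis
    by (simp only: diff_diff_add[symmetric] diff_self diff_0 add_diff_cancel_left' mult.commute)
qed

lemma markov_WZ:
  assumes "x + 1 \<noteq> 0" "x + of_nat n + 2 \<noteq> 0"
  shows "markov_F (Suc n) x - markov_F n x = markov_G n (x + 1) - markov_G n x"
proof -
  define u m where "u = x + 1" and "m = (of_nat (Suc n) :: complex)"
  have x: "x = u - 1" and n: "of_nat n = m - 1" "of_nat (2 * n + 1) = 2 * m - 1"
    "x + of_nat n + 2 = u + m"
    by (simp_all add: u_def m_def)
  have nz: "u + m \<noteq> 0" "2 * m - 1 \<noteq> 0"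
    using assms(2) n(3) by (simp, metis n(2) of_nat_eq_0_iff add_is_0 one_neq_zero)
  have h1: "markov_h (Suc n) x = - (m ^ 5 / (2 * (2 * m - 1) * (u + m) ^ 4)) * markov_h n x"
    unfolding markov_h_Suc n(2,3) m_def[symmetric] ..
  have h2: "markov_h n (x + 1) = (u / (u + m)) ^ 4 * markov_h n x"
    using markov_h_shift[OF assms(1), of n] unfolding n(3) u_def .
  define H D E where "H = markov_h n x" and "D = (u + m) ^ 4" and "E = 2 * m - 1"
  have DE: "D \<noteq> 0" "E \<noteq> 0"
    using nz by (simp_all add: D_def E_def)
  have lin: "2 * x + of_nat (Suc n) + 2 = 2 * u + m" "2 * x + of_nat n + 2 = 2 * u + m - 1"
    by (simp_all add: u_def m_def)
  \<comment> \<open>Keeping \<open>H\<close>, \<open>D\<close>, \<open>E\<close> and the polynomials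
    opaque lets denominators be cleared without expansion; both sides of the WZ relation acquire the
    same factor \<open>H / (4 * E * D)\<close>.\<close>
  have "- (a / (2 * E * D)) * H * b / 2 - H * c / 2 = H / (4 * E * D) * (- (a * b) - 2 * E * c * D)"
    for a b c
    using DE by (simp add: field_simps)
  then have "markov_F (Suc n) x - markov_F n x = H / (4 * E * D) *
      (- (m ^ 5 * (2 * u + m)) - 2 * E * (2 * u + m - 1) * D)"
    unfolding markov_F_def h1 lin H_def[symmetric] D_def[symmetric] E_def[symmetric] .
  moreover have "u ^ 4 / D * H * p / (4 * E) - H * q / (4 * E) = H / (4 * E * D) * (u ^ 4 * p - D * q)"
    for p q
    using DE by (simp add: field_simps)
  then have "markov_G n (x + 1) - markov_G n x = H / (4 * E * D) *
      (u ^ 4 * (5 * m ^ 2 + 6 * m * u + 2 * u ^ 2)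
      - D * (5 * m ^ 2 + 6 * m * (u - 1) + 2 * (u - 1) ^ 2))"
    unfolding markov_G_def h2 n(2) power_divide H_def[symmetric] D_def[symmetric] E_def[symmetric]
      m_def[symmetric] unfolding u_def[symmetric] x[symmetric] .
  ultimately show ?thesis
    unfolding D_def E_def markov_WZ_polynomial by simp
qed

section \<open>Geometric decay in \<open>n\<close>, uniform along \<open>z + k\<close>\<close>

lemma norm_add_of_nat_ge: "real n - norm z \<le> norm (z + of_nat n :: complex)"
  by (metis add.commute norm_diff_ineq norm_of_nat)

text \<open>The ratio has modulus \<open>m^5 / (2(2m - 1) d^4)\<close>. The threshold on
  \<open>n\<close> gives \<open>d \<ge> 9/10 m\<close>, and \<open>k\<close> only improves this
  bound, hence the uniformity. As \<open>m \<ge> 2\<close> and \<open>(9/10)^4 = 6561/10000\<close>,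
  the ratio stays below \<open>3/5\<close>.\<close>

lemma norm_markov_h_Suc_le:
  assumes "10 * norm z + 1 \<le> real n"
  shows "norm (markov_h (Suc n) (z + of_nat k)) \<le> 3 / 5 * norm (markov_h n (z + of_nat k))"
proof -
  define m d where "m = real (Suc n)" and "d = norm (z + of_nat k + of_nat n + 2)"
  have m: "m \<ge> 2"
    using assms norm_ge_zero[of z] unfolding m_def of_nat_Suc by linarith
  have "real (k + n + 2) - norm z \<le> d"
    using norm_add_of_nat_ge[of "k + n + 2" z] by (simp add: d_def add_ac)
  then have d: "9 / 10 * m \<le> d"
    using assms by (simp add: m_def)
  then have "(9 / 10 * m) ^ 4 \<le> d ^ 4"
    using m by (intro power_mono) auto
  then have d4: "6561 / 10000 * m ^ 4 \<le> d ^ 4"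
    by (simp add: power_mult_distrib power_divide)
  have "m ^ 5 = m * m ^ 4"
    by (simp add: power_numeral_reduce)
  also have "\<dots> \<le> (6 / 5 * (2 * m - 1)) * (6561 / 10000 * m ^ 4)"
  proof -
    have "m \<le> 6 / 5 * (2 * m - 1) * (6561 / 10000)"
      using m by simp
    then have "m * m ^ 4 \<le> (6 / 5 * (2 * m - 1) * (6561 / 10000)) * m ^ 4"
      by (rule mult_right_mono) simp
    then show ?thesis by (simp add: mult_ac)
  qed
  also have "\<dots> \<le> (6 / 5 * (2 * m - 1)) * d ^ 4"
    using m d4 by (intro mult_left_mono) auto
  finally have "m ^ 5 / (2 * (2 * m - 1) * d ^ 4) \<le> 3 / 5"
    using m d by (subst pos_divide_le_eq) (auto simp: algebra_simps)
  moreover have "norm (of_nat (Suc n) ^ 5 / (2 * of_nat (2 * n + 1) * (z + of_nat k + of_nat n + 2) ^ 4))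
      = m ^ 5 / (2 * (2 * m - 1) * d ^ 4)"
    unfolding norm_divide norm_mult norm_power norm_of_nat d_def m_def by simp
  ultimately show ?thesis
    unfolding markov_h_Suc norm_mult norm_minus_cancel
    by (metis mult_right_mono norm_ge_zero)
qed

lemma norm_markov_F_Suc_le:
  assumes "10 * norm z + 4 \<le> real n"
  shows "norm (markov_F (Suc n) (z + of_nat k)) \<le> 3 / 4 * norm (markov_F n (z + of_nat k))"
proof -
  \<comment> \<open>The linear factor of \<open>markov_F n\<close>; that of
    \<open>markov_F (Suc n)\<close> is \<open>l + 1\<close>. Since \<open>norm l \<ge> 4\<close>, it
    grows by at most \<open>5/4\<close>, and \<open>3/5 * 5/4 = 3/4\<close>.\<close>
  define l where "l = 2 * (z + of_nat k) + of_nat n + 2"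
  have "real (2 * k + n + 2) - norm (2 * z) \<le> norm l"
    using norm_add_of_nat_ge[of "2 * k + n + 2" "2 * z"] by (simp add: l_def algebra_simps)
  then have "real n + 2 - 2 * norm z \<le> norm l"
    by (simp add: norm_mult)
  then have "4 \<le> norm l"
    using assms norm_ge_zero[of z] by linarith
  moreover have "norm (l + 1) \<le> norm l + 1"
    using norm_triangle_ineq[of l 1] by simp
  ultimately have l: "norm (l + 1) \<le> 5 / 4 * norm l"
    by simp
  have "norm (markov_h (Suc n) (z + of_nat k)) * norm (l + 1) \<le>
      (3 / 5 * norm (markov_h n (z + of_nat k))) * (5 / 4 * norm l)"
    using assms by (intro mult_mono norm_markov_h_Suc_le l) auto
  moreover have "markov_F (Suc n) (z + of_nat k) = markov_h (Suc n) (z + of_nat k) * (l + 1) / 2"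
    "markov_F n (z + of_nat k) = markov_h n (z + of_nat k) * l / 2"
    by (simp_all add: markov_F_def l_def algebra_simps)
  ultimately show ?thesis
    by (simp only: norm_mult norm_divide) (simp add: mult_ac)
qed

lemma geometric_bound:
  fixes f :: "nat \<Rightarrow> real"
  assumes "\<And>n. N \<le> n \<Longrightarrow> f (Suc n) \<le> c * f n" "0 \<le> c"
  shows "f (N + n) \<le> c ^ n * f N"
proof (induction n)
  case (Suc n)
  have "f (N + Suc n) \<le> c * f (N + n)"
    using assms(1)[of "N + n"] by simp
  also have "\<dots> \<le> c * (c ^ n * f N)"
    by (intro mult_left_mono Suc assms)
  finally show ?case by (simp add: mult_ac)
qed simp

lemma tendsto_0_geometric:
  fixes f :: "nat \<Rightarrow> 'a::real_normed_vector"
  assumes bound: "\<And>n. norm (f (n + N)) \<le> c ^ n * B" and "0 \<le> c" "c < 1"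
  shows "f \<longlonglongrightarrow> 0"
proof -
  have "(\<lambda>n. c ^ n * B) \<longlonglongrightarrow> 0"
    using assms(2,3) by (intro tendsto_mult_left_zero LIMSEQ_realpow_zero)
  then have "(\<lambda>n. f (n + N)) \<longlonglongrightarrow> 0"
    by (rule Lim_null_comparison[OF always_eventually[OF allI[OF bound]]])
  then show ?thesis
    by (rule LIMSEQ_offset)
qed

section \<open>Behaviour in \<open>k\<close> for fixed \<open>n\<close>\<close>

lemma tendsto_inverse_add_of_nat:
  "(\<lambda>k. inverse (z + of_nat k :: complex)) \<longlonglongrightarrow> 0"
  by (intro filterlim_compose[OF tendsto_inverse_0] tendsto_add_filterlim_at_infinity[OF tendsto_const]
      tendsto_of_nat)

text \<open>The limit is 1 for \<open>n = 0\<close> and 0 otherwise. Convergence suffices below,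
  where this is multiplied by something tending to 0.\<close>

lemma convergent_inverse_pochhammer:
  "convergent (\<lambda>k. inverse (pochhammer (z + of_nat k :: complex) n))"
proof (induction n)
  case (Suc n)
  have "(\<lambda>k. inverse (z + of_nat n + of_nat k)) \<longlonglongrightarrow> 0"
    by (rule tendsto_inverse_add_of_nat)
  then have "convergent (\<lambda>k. inverse (z + of_nat n + of_nat k))"
    by (rule convergentI)
  from convergent_mult[OF Suc this] show ?case
    by (simp add: pochhammer_Suc add_ac)
qed (simp add: convergent_const)

text \<open>The first Pochhammer factor alone contributes \<open>(x + 1)^4\<close> to the
  denominator, which beats the quadratic numerator; the remaining factors \<open>p\<close>
  converge.\<close>

lemma markov_G_tendsto_0:
  "(\<lambda>k. markov_G n (z + of_nat k)) \<longlonglongrightarrow> 0"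
proof -
  define m where "m = (of_nat (Suc n) :: complex)"
  define c where "c = (- 1) ^ n * fact n ^ 6 / (fact (2 * n) * (4 * of_nat (2 * n + 1)) :: complex)"
  define w where "w k = inverse (z + 1 + of_nat k)" for k
  define p where "p k = inverse (pochhammer (z + 2 + of_nat k) n)" for k
  have w: "w \<longlonglongrightarrow> 0"
    unfolding w_def by (rule tendsto_inverse_add_of_nat)
  obtain L where p: "p \<longlonglongrightarrow> L"
    using convergent_inverse_pochhammer[of "z + 2" n] unfolding p_def convergent_def by blast
  \<comment> \<open>Substituting \<open>x = 1 / w - 1\<close> turns the quadratic times
    \<open>w^4\<close> into a polynomial in \<open>w\<close> with lowest term
    \<open>2 w^2\<close>.\<close>
  have eq: "markov_G n (z + of_nat k) =
      c * (p k ^ 4 * (2 * w k ^ 2 + (6 * m - 4) * w k ^ 3 + (5 * m ^ 2 - 6 * m + 2) * w k ^ 4))"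
    if "w k \<noteq> 0" for k
  proof -
    have x: "z + of_nat k = inverse (w k) - 1" and "z + of_nat k + 1 = inverse (w k)"
      by (simp_all add: w_def add_ac)
    moreover have "pochhammer (z + of_nat k + 1) (Suc n) =
        (z + of_nat k + 1) * pochhammer (z + 2 + of_nat k) n"
      unfolding pochhammer_rec by (simp add: add_ac)
    ultimately have poch: "pochhammer (z + of_nat k + 1) (Suc n) = inverse (w k) * inverse (p k)"
      by (simp add: p_def)
    have poly: "w k ^ 4 * (5 * m ^ 2 + 6 * m * (inverse (w k) - 1) + 2 * (inverse (w k) - 1) ^ 2) =
        2 * w k ^ 2 + (6 * m - 4) * w k ^ 3 + (5 * m ^ 2 - 6 * m + 2) * w k ^ 4"
      using that by (simp add: field_simps power_numeral_reduce)
    show ?thesis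
      unfolding poly[symmetric] markov_G_def markov_h_def poch m_def[symmetric] c_def
      unfolding x
      by (simp add: power_mult_distrib divide_inverse power_inverse mult_ac)
  qed
  \<comment> \<open>As \<open>inverse 0 = 0\<close>, \<open>w k\<close> vanishes exactly when
    \<open>z + 1 + k = 0\<close>.\<close>
  have ev: "eventually (\<lambda>k. w k \<noteq> 0) sequentially"
  proof -
    have "eventually (\<lambda>k. norm (z + 1) + 1 \<le> real k) sequentially"
      using eventually_ge_at_top[of "nat \<lceil>norm (z + 1) + 1\<rceil>"] by eventually_elim linarith
    then show ?thesis
    proof eventually_elim
      case (elim k)
      then have "0 < norm (z + 1 + of_nat k)"
        using norm_add_of_nat_ge[of k "z + 1"] by linarith
      then show ?case by (auto simp: w_def)
    qed
  qed
  have "(\<lambda>k. c * (p k ^ 4 * (2 * w k ^ 2 + (6 * m - 4) * w k ^ 3 + (5 * m ^ 2 - 6 * m + 2) * w k ^ 4)))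
      \<longlonglongrightarrow> c * (L ^ 4 * (2 * 0 ^ 2 + (6 * m - 4) * 0 ^ 3 + (5 * m ^ 2 - 6 * m + 2) * 0 ^ 4))"
    by (intro tendsto_intros p w)
  then show ?thesis
    using ev eq by (simp add: tendsto_cong[OF eventually_mono[OF ev eq]])
qed

lemma markov_F_0: "markov_F 0 x = 1 / (x + 1) ^ 3"
proof -
  have "2 * x + of_nat 0 + 2 = 2 * (x + 1)" by simp
  then have "markov_F 0 x = (x + 1) / (x + 1) ^ 4"
    unfolding markov_F_def markov_h_def by (simp only:) (simp del: distrib_left_numeral)
  then show ?thesis
    by (simp add: power_numeral_reduce)
qed

text \<open>Induction on \<open>n\<close>: the base case compares with the series of
  \<open>1 / k^3\<close>, and for large \<open>k\<close> the step from \<open>n\<close> to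
  \<open>n + 1\<close> costs only a factor independent of \<open>k\<close>.\<close>

lemma summable_norm_markov_F: "summable (\<lambda>k. norm (markov_F n (z + of_nat k)))"
proof (induction n)
  case 0
  have "eventually (\<lambda>k. 2 * norm (z + 1) + 1 \<le> real k) sequentially"
    using eventually_ge_at_top[of "nat \<lceil>2 * norm (z + 1) + 1\<rceil>"] by eventually_elim linarith
  then have "eventually (\<lambda>k. norm (norm (markov_F 0 (z + of_nat k))) \<le> 8 * inverse (real k ^ 3))
      sequentially"
  proof eventually_elim
    case (elim k)
    have k: "0 < real k"
      using elim norm_ge_zero[of "z + 1"] by linarith
    have "real k / 2 \<le> norm (z + 1 + of_nat k)"
      using norm_add_of_nat_ge[of k "z + 1"] elim by linarith
    then have "inverse (norm (z + 1 + of_nat k) ^ 3) \<le> inverse ((real k / 2) ^ 3)"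
      using k by (intro le_imp_inverse_le power_mono) auto
    then show ?case
      by (simp add: markov_F_0 norm_divide norm_power power_divide divide_simps add_ac)
  qed
  then show ?case
    by (rule summable_comparison_test_ev) (intro summable_mult inverse_power_summable, simp)
next
  case (Suc n)
  \<comment> \<open>\<open>(n + 1)^5\<close> is the numerator of the ratio of
    \<open>markov_h\<close>, whose denominator \<open>q\<close> has norm at least 1; the 2 bounds
    the growth from \<open>l\<close> to \<open>l + 1\<close>.\<close>
  define C where "C = 2 * real (Suc n) ^ 5"
  have "eventually (\<lambda>k. 2 * norm z + 1 \<le> real k) sequentially"
    using eventually_ge_at_top[of "nat \<lceil>2 * norm z + 1\<rceil>"] by eventually_elim linarith
  then have "eventually (\<lambda>k. norm (norm (markov_F (Suc n) (z + of_nat k))) \<le>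
      C * norm (markov_F n (z + of_nat k))) sequentially"
  proof eventually_elim
    case (elim k)
    define x l where "x = z + of_nat k" and "l = 2 * x + of_nat n + 2"
    define q where "q = 2 * of_nat (2 * n + 1) * (x + of_nat n + 2) ^ 4"
    have "1 \<le> norm (x + of_nat n + 2)"
      using norm_add_of_nat_ge[of "k + n + 2" z] elim norm_ge_zero[of z]
      by (simp add: x_def add_ac)
    then have "1 * 1 \<le> (2 * real (2 * n + 1)) * norm (x + of_nat n + 2) ^ 4"
      by (intro mult_mono one_le_power) auto
    then have q: "1 \<le> norm q"
      unfolding q_def norm_mult norm_power norm_of_nat by simp
    have "real (2 * k + n + 2) - norm (2 * z) \<le> norm l"
      using norm_add_of_nat_ge[of "2 * k + n + 2" "2 * z"]
      by (simp add: l_def x_def algebra_simps)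
    then have "1 \<le> norm l"
      using elim norm_ge_zero[of z] by (simp add: norm_mult)
    moreover have "norm (l + 1) \<le> norm l + 1"
      using norm_triangle_ineq[of l 1] by simp
    ultimately have l: "norm (l + 1) \<le> 2 * norm l"
      by simp
    have F: "markov_F (Suc n) x = - (of_nat (Suc n) ^ 5 / q * markov_h n x * (l + 1) / 2)"
      "markov_F n x = markov_h n x * l / 2"
      unfolding markov_F_def markov_h_Suc q_def[symmetric] by (simp_all add: l_def add_ac)
    have "norm (of_nat (Suc n) ^ 5 / q) \<le> real (Suc n) ^ 5"
      unfolding norm_divide norm_power norm_of_nat
      using q divide_left_mono[of 1 "norm q" "real (Suc n) ^ 5"] by (cases "q = 0") simp_all
    then have "norm (of_nat (Suc n) ^ 5 / q) * norm (markov_h n x) * norm (l + 1) \<le>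
        real (Suc n) ^ 5 * norm (markov_h n x) * (2 * norm l)"
      by (intro mult_mono l) auto
    then have "norm (markov_F (Suc n) x) \<le> C * norm (markov_F n x)"
      unfolding F norm_minus_cancel C_def norm_mult norm_divide by (simp add: mult_ac)
    then show ?case
      by (simp add: x_def)
  qed
  then show ?case
    by (rule summable_comparison_test_ev) (intro summable_mult Suc)
qed

section \<open>Limits in \<open>n\<close> and summation of the series\<close>

text \<open>Since \<open>c\<close> does not depend on \<open>k\<close>, the factor
  \<open>c ^ n\<close> can be pulled out of the sum over \<open>k\<close>.\<close>

lemma suminf_tendsto_0_geometric:
  fixes f :: "nat \<Rightarrow> nat \<Rightarrow> complex"
  assumes "\<And>n k. N \<le> n \<Longrightarrow> norm (f (Suc n) k) \<le> c * norm (f n k)" "0 \<le> c" "c < 1"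
    and "\<And>n. summable (\<lambda>k. norm (f n k))"
  shows "(\<lambda>n. \<Sum>k. f n k) \<longlonglongrightarrow> 0"
proof -
  have "norm (\<Sum>k. f (n + N) k) \<le> c ^ n * (\<Sum>k. norm (f N k))" for n
  proof -
    have "norm (f (n + N) k) \<le> c ^ n * norm (f N k)" for k
      using geometric_bound[of N "\<lambda>n. norm (f n k)" c n] assms(1,2) by (simp add: add.commute)
    then have "norm (\<Sum>k. f (n + N) k) \<le> (\<Sum>k. c ^ n * norm (f N k))"
      by (intro norm_suminf_le summable_mult assms)
    also have "\<dots> = c ^ n * (\<Sum>k. norm (f N k))"
      by (intro suminf_mult assms)
    finally show ?thesis .
  qed
  then show ?thesis
    by (rule tendsto_0_geometric) (use assms in auto)
qed

lemma markov_h_tendsto_0: "(\<lambda>n. markov_h n z) \<longlonglongrightarrow> 0"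
proof -
  define N where "N = nat \<lceil>10 * norm z + 1\<rceil>"
  have "norm (markov_h (n + N) z) \<le> (3 / 5) ^ n * norm (markov_h N z)" for n
    using geometric_bound[of N "\<lambda>n. norm (markov_h n z)" "3 / 5" n] norm_markov_h_Suc_le[of z _ 0]
    unfolding N_def by (simp add: add.commute nat_ceiling_le_eq)
  then show ?thesis
    by (rule tendsto_0_geometric) auto
qed

theorem markov_G_sums:
  assumes "\<And>n. z + of_nat (Suc n) \<noteq> 0"
  shows "(\<lambda>n. markov_G n z) sums hurwitz_zeta (z + 1) 3"
proof -
  define S where "S n = (\<Sum>k. markov_F n (z + of_nat k))" for n
  have summ: "summable (\<lambda>k. markov_F n (z + of_nat k))" for n
    by (rule summable_norm_cancel[OF summable_norm_markov_F])
  have step: "markov_G n z = S n - S (Suc n)" for n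
  proof -
    \<comment> \<open>The two instances of the hypothesis exclude the zeros of \<open>x + 1\<close>
      and \<open>x + n + 2\<close> at \<open>x = z + k\<close>.\<close>
    have "markov_F (Suc n) (z + of_nat k) - markov_F n (z + of_nat k) =
        markov_G n (z + of_nat (Suc k)) - markov_G n (z + of_nat k)" for k
      using markov_WZ[of "z + of_nat k" n] assms[of k] assms[of "k + n + 1"]
      by (simp add: add_ac)
    moreover have "(\<lambda>k. markov_G n (z + of_nat (Suc k)) - markov_G n (z + of_nat k)) sums
        (0 - markov_G n (z + of_nat 0))"
      by (rule telescope_sums[OF markov_G_tendsto_0])
    ultimately have "(\<lambda>k. markov_F (Suc n) (z + of_nat k) - markov_F n (z + of_nat k)) sums
        (- markov_G n z)"
      by simp
    then have "S (Suc n) - S n = - markov_G n z"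
      unfolding S_def suminf_diff[OF summ summ] by (rule sums_unique[symmetric])
    then show ?thesis
      by (simp add: algebra_simps)
  qed
  have "S \<longlonglongrightarrow> 0"
    unfolding S_def
  proof (rule suminf_tendsto_0_geometric)
    show "norm (markov_F (Suc n) (z + of_nat k)) \<le> 3 / 4 * norm (markov_F n (z + of_nat k))"
      if "nat \<lceil>10 * norm z + 4\<rceil> \<le> n" for n k
      using that by (intro norm_markov_F_Suc_le) linarith
  qed (auto intro: summable_norm_markov_F)
  \<comment> \<open>The first telescoping was in \<open>k\<close>; this one is in
    \<open>n\<close>.\<close>
  then have "(\<lambda>n. S n - S (Suc n)) sums (S 0 - 0)"
    by (rule telescope_sums')
  moreover have "S 0 = hurwitz_zeta (z + 1) 3"
    unfolding S_def hurwitz_zeta_def by (simp add: markov_F_0 add_ac)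
  ultimately show ?thesis
    by (simp add: step)
qed

section \<open>The diagonal entries and the matrix products\<close>

text \<open>The factors \<open>2k(2k + 1)\<close> multiply to \<open>(2n + 1)!\<close> where
  \<open>markov_h\<close> has \<open>(2n)!\<close>, hence \<open>1 / (2n + 1)\<close>. The factors
  \<open>z + k + 1\<close> start at \<open>z + 2\<close>, so \<open>(z + 1)^4\<close> cancels the
  extra Pochhammer factor.\<close>

lemma markov_prod:
  assumes "\<And>n. z + of_nat (Suc n) \<noteq> 0"
  shows "(\<Prod>k=1..n. - (of_nat k ^ 6 / (2 * of_nat k * (2 * of_nat k + 1) * (z + of_nat k + 1) ^ 4))) =
    (z + 1) ^ 4 / of_nat (2 * n + 1) * markov_h n z"
proof (induction n)
  case 0
  show ?case
    using assms[of 0] by (simp add: markov_h_def add_ac)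
next
  case (Suc n)
  define m :: complex where "m = of_nat (Suc n)"
  have m: "m \<noteq> 0" unfolding m_def by (simp only: of_nat_eq_0_iff)
  have m6: "m ^ 6 = m ^ 5 * m"
    by (simp add: power_numeral_reduce)
  have n: "z + m + 1 = z + of_nat n + 2" "2 * m + 1 = of_nat (2 * Suc n + 1)"
    by (simp_all add: m_def)
  have nz: "of_nat (2 * n + 1) \<noteq> (0 :: complex)"
    by (simp only: of_nat_eq_0_iff)
  show ?case
    unfolding prod.cl_ivl_Suc markov_h_Suc Suc m_def[symmetric] n m6
    using m nz by (simp add: mult_ac del: of_nat_Suc of_nat_add)
qed

theorem theorem7p1:
  fixes z :: complex
  assumes "z \<notin> {- of_nat n | n :: nat. n \<ge> 1}"
  shows
    "has_matrix_prod
       (\<lambda>k. vector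
          [vector [- (of_nat k ^ 6 / (2 * of_nat k * (2 * of_nat k + 1) * (z + of_nat k + 1) ^ 4)),
                   5 * of_nat k ^ 2 + 6 * of_nat k * z + 2 * z ^ 2],
           vector [0, 1]] :: complex ^ 2 ^ 2)
       (vector
          [vector [0, 4 * (z + 1) ^ 4 * hurwitz_zeta (z + 1) 3],
           vector [0, 1]])
     \<and>
     has_matrix_prod
       (\<lambda>k. vector
          [vector [- (of_nat k ^ 6 / (2 * of_nat k * (2 * of_nat k + 1) * (z + of_nat k + 1) ^ 4)),
                   (5 * of_nat k ^ 2 + 6 * of_nat k * z + 2 * z ^ 2) / (4 * (z + 1) ^ 4)],
           vector [0, 1]] :: complex ^ 2 ^ 2)
       (vector
          [vector [0, hurwitz_zeta (z + 1) 3],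
           vector [0, 1]])"
proof -
  have nz: "z + of_nat (Suc n) \<noteq> 0" for n
    using assms by (auto simp: add_eq_0_iff2 simp del: of_nat_Suc)
  have z1: "z + 1 \<noteq> 0"
    using nz[of 0] by simp
  note sums = markov_G_sums[OF nz]
  have "(\<lambda>n. (z + 1) ^ 4 * inverse (of_nat (2 * n + 1)) * markov_h n z) \<longlonglongrightarrow> (z + 1) ^ 4 * 0 * 0"
  proof (intro tendsto_mult tendsto_const markov_h_tendsto_0)
    \<comment> \<open>\<open>1 / (2n + 1)\<close> is treated as a subsequence of
      \<open>1 / k\<close>.\<close>
    have "strict_mono (\<lambda>n::nat. 2 * n + 1)"
      by (simp add: strict_mono_def)
    from LIMSEQ_subseq_LIMSEQ[OF tendsto_inverse_add_of_nat[of 0] this]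
    show "(\<lambda>n. inverse (of_nat (2 * n + 1) :: complex)) \<longlonglongrightarrow> 0"
      by (simp add: o_def)
  qed
  then have lim: "(\<lambda>n. (z + 1) ^ 4 / of_nat (2 * n + 1) * markov_h n z) \<longlonglongrightarrow> 0"
    by (simp add: divide_inverse)
  show ?thesis
  proof (intro conjI has_matrix_prod_affineI, unfold markov_prod[OF nz])
    \<comment> \<open>The product of the first \<open>n\<close> diagonal entries times the upper
      right entry of factor \<open>Suc n\<close> is exactly \<open>4 (z + 1)^4\<close> times
      \<open>markov_G n z\<close>.\<close>
    have "(\<lambda>n. 4 * (z + 1) ^ 4 * markov_G n z) sums (4 * (z + 1) ^ 4 * hurwitz_zeta (z + 1) 3)"
      by (rule sums_mult[OF sums])
    then show "(\<lambda>n. (z + 1) ^ 4 / of_nat (2 * n + 1) * markov_h n z *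
        (5 * of_nat (Suc n) ^ 2 + 6 * of_nat (Suc n) * z + 2 * z ^ 2)) sums
        (4 * (z + 1) ^ 4 * hurwitz_zeta (z + 1) 3)"
      by (simp add: markov_G_def mult_ac del: of_nat_Suc of_nat_add)
    show "(\<lambda>n. (z + 1) ^ 4 / of_nat (2 * n + 1) * markov_h n z *
        ((5 * of_nat (Suc n) ^ 2 + 6 * of_nat (Suc n) * z + 2 * z ^ 2) / (4 * (z + 1) ^ 4))) sums
        hurwitz_zeta (z + 1) 3"
      using sums z1 by (simp add: markov_G_def mult_ac del: of_nat_Suc of_nat_add)
  qed (rule lim)+
qed

end
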